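(* For all $a, x \in \mathbb{O}$, $$\overrightarrow{xa} = \nu(a)\,\overrightarrow{x}.$$
   Context: $\mathbb{H}$ is the real quaternion algebra with basis $1,i,j,k$, $i^2=j^2=k^2=ijk=-1$, and conjugation $q\mapsto\overline{q}$. The real octonion algebra $\mathbb{O}$ consists of elements $a=a'+a''e$ with $a',a''\in\mathbb{H}$, with componentwise addition and product $(a'+a''e)(b'+b''e)=(a'b'-\overline{b''}a'')+(b''a'+a''\overline{b'})e$. Its canonical basis is $e_0=1,\ e_1=i,\ e_2=j,\ e_3=k,\ e_4=e,\ e_5=ie,\ e_6=je,\ e_7=ke$. For $x=x_0+x_1e_1+\cdots+x_7e_7\in\mathbb{O}$ with real $x_0,\dots,x_7$, put $\overrightarrow{x}=[x_0,x_1,\dots,x_7]^T\in\mathbb{R}^{8}$. For $q=q_0+q_1i+q_2j+q_3k\in\mathbb{H}$ put $$\phi(q)=\begin{bmatrix} q_0&-q_1&-q_2&-q_3\\ q_1&q_0&-q_3&q_2\\ q_2&q_3&q_0&-q_1\\ q_3&-q_2&q_1&q_0\end{bmatrix},\quad \tau(q)=\begin{bmatrix} q_0&-q_1&-q_2&-q_3\\ q_1&q_0&q_3&-q_2\\ q_2&-q_3&q_0&q_1\\ q_3&q_2&-q_1&q_0\end{bmatrix}.$$ For $a=a'+a''e\in\mathbb{O}$, the right matrix representation is the $8\times 8$ real matrix $$\nu(a)=\begin{bmatrix}\tau(a') & -\phi(\overline{a''})\\ \phi(a'')&\tau(\overline{a'})\end{bmatrix}.$$ *)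

theory Defs
  imports Complex_Main "Jordan_Normal_Form.Matrix"
begin

section \<open>Quaternions\<close>

datatype quat = Quat (q0: real) (q1: real) (q2: real) (q3: real)

lemma quat_eq_iff: "p = q \<longleftrightarrow> q0 p = q0 q \<and> q1 p = q1 q \<and> q2 p = q2 q \<and> q3 p = q3 q"
  by (auto intro: quat.expand)

instantiation quat :: real_algebra_1
begin

definition zero_quat :: quat where "0 = Quat 0 0 0 0"

definition one_quat :: quat where "1 = Quat 1 0 0 0"

definition plus_quat :: "quat \<Rightarrow> quat \<Rightarrow> quat" where
  "p + q = Quat (q0 p + q0 q) (q1 p + q1 q) (q2 p + q2 q) (q3 p + q3 q)"

definition uminus_quat :: "quat \<Rightarrow> quat" where
  "- p = Quat (- q0 p) (- q1 p) (- q2 p) (- q3 p)"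

definition minus_quat :: "quat \<Rightarrow> quat \<Rightarrow> quat" where
  "p - q = Quat (q0 p - q0 q) (q1 p - q1 q) (q2 p - q2 q) (q3 p - q3 q)"

definition scaleR_quat :: "real \<Rightarrow> quat \<Rightarrow> quat" where
  "c *\<^sub>R p = Quat (c * q0 p) (c * q1 p) (c * q2 p) (c * q3 p)"

text \<open>The bilinear extension of the Hamilton relations; see \<open>quat_hamilton\<close> below.\<close>

definition times_quat :: "quat \<Rightarrow> quat \<Rightarrow> quat" where
  "p * q = Quat
     (q0 p * q0 q - q1 p * q1 q - q2 p * q2 q - q3 p * q3 q)
     (q0 p * q1 q + q1 p * q0 q + q2 p * q3 q - q3 p * q2 q)
     (q0 p * q2 q - q1 p * q3 q + q2 p * q0 q + q3 p * q1 q)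
     (q0 p * q3 q + q1 p * q2 q - q2 p * q1 q + q3 p * q0 q)"

instance
  by standard
    (auto simp: quat_eq_iff zero_quat_def one_quat_def plus_quat_def uminus_quat_def
      minus_quat_def scaleR_quat_def times_quat_def algebra_simps)

end

lemmas quat_defs = zero_quat_def one_quat_def plus_quat_def uminus_quat_def
  minus_quat_def scaleR_quat_def times_quat_def

definition quat_i :: quat where "quat_i = Quat 0 1 0 0"
definition quat_j :: quat where "quat_j = Quat 0 0 1 0"
definition quat_k :: quat where "quat_k = Quat 0 0 0 1"

lemma quat_hamilton:
  "quat_i * quat_i = -1" "quat_j * quat_j = -1" "quat_k * quat_k = -1"
  "quat_i * quat_j * quat_k = -1"
  by (simp_all add: quat_defs quat_i_def quat_j_def quat_k_def)

lemma quat_basis_expansion: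
  "Quat a b c d = a *\<^sub>R 1 + b *\<^sub>R quat_i + c *\<^sub>R quat_j + d *\<^sub>R quat_k"
  by (simp add: quat_defs quat_i_def quat_j_def quat_k_def)

definition qcnj :: "quat \<Rightarrow> quat" where
  "qcnj q = Quat (q0 q) (- q1 q) (- q2 q) (- q3 q)"


section \<open>Octonions\<close>

text \<open>\<open>Oct a' a''\<close> stands for \<open>a' + a'' e\<close>; see \<open>oct_decomp\<close> below.\<close>

datatype oct = Oct (oct1: quat) (oct2: quat)

lemma oct_eq_iff: "x = y \<longleftrightarrow> oct1 x = oct1 y \<and> oct2 x = oct2 y"
  by (auto intro: oct.expand)

instantiation oct :: real_vector
begin

definition zero_oct :: oct where "0 = Oct 0 0"

definition plus_oct :: "oct \<Rightarrow> oct \<Rightarrow> oct" where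
  "x + y = Oct (oct1 x + oct1 y) (oct2 x + oct2 y)"

definition uminus_oct :: "oct \<Rightarrow> oct" where
  "- x = Oct (- oct1 x) (- oct2 x)"

definition minus_oct :: "oct \<Rightarrow> oct \<Rightarrow> oct" where
  "x - y = Oct (oct1 x - oct1 y) (oct2 x - oct2 y)"

definition scaleR_oct :: "real \<Rightarrow> oct \<Rightarrow> oct" where
  "c *\<^sub>R x = Oct (c *\<^sub>R oct1 x) (c *\<^sub>R oct2 x)"

instance
  by standard
    (auto simp: oct_eq_iff zero_oct_def plus_oct_def uminus_oct_def minus_oct_def
      scaleR_oct_def scaleR_add_right scaleR_add_left)

end

text \<open>The product is not associative, so only the syntactic classes are instantiated for it.\<close>

instantiation oct :: "{one, times}"
begin

definition one_oct :: oct where "1 = Oct 1 0"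

definition times_oct :: "oct \<Rightarrow> oct \<Rightarrow> oct" where
  "a * b = Oct (oct1 a * oct1 b - qcnj (oct2 b) * oct2 a)
               (oct2 b * oct1 a + oct2 a * qcnj (oct1 b))"

instance ..

end

lemmas oct_defs = zero_oct_def one_oct_def plus_oct_def uminus_oct_def
  minus_oct_def scaleR_oct_def times_oct_def

definition oct_of_quat :: "quat \<Rightarrow> oct" where "oct_of_quat q = Oct q 0"

definition oct_e :: oct where "oct_e = Oct 0 1"

lemma oct_decomp: "Oct a b = oct_of_quat a + oct_of_quat b * oct_e"
  by (simp add: oct_defs oct_of_quat_def oct_e_def qcnj_def quat_defs)

definition oct_basis :: "nat \<Rightarrow> oct" where
  "oct_basis n =
    [1, oct_of_quat quat_i, oct_of_quat quat_j, oct_of_quat quat_k, oct_e,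
     oct_of_quat quat_i * oct_e, oct_of_quat quat_j * oct_e, oct_of_quat quat_k * oct_e] ! n"

definition oct_vec :: "oct \<Rightarrow> real vec" where
  "oct_vec x = vec_of_list
    [q0 (oct1 x), q1 (oct1 x), q2 (oct1 x), q3 (oct1 x),
     q0 (oct2 x), q1 (oct2 x), q2 (oct2 x), q3 (oct2 x)]"

text \<open>\<open>oct_vec\<close> is the coordinate vector with respect to \<open>oct_basis\<close>.\<close>

lemma oct_vec_coords: "oct_vec (\<Sum>n<8. c n *\<^sub>R oct_basis n) = vec 8 c"
  by (simp add: oct_vec_def oct_basis_def lessThan_nat_numeral oct_defs oct_of_quat_def oct_e_def
      quat_defs quat_i_def quat_j_def quat_k_def qcnj_def vec_eq_iff numeral_eq_Suc
      less_Suc_eq lessThan_Suc vec_of_list_index all_conj_distrib)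

lemma oct_basis_expansion: "x = (\<Sum>n<8. oct_vec x $ n *\<^sub>R oct_basis n)"
  by (simp add: oct_vec_def oct_basis_def numeral_eq_Suc lessThan_Suc oct_defs oct_of_quat_def
      oct_e_def quat_defs quat_i_def quat_j_def quat_k_def qcnj_def oct_eq_iff quat_eq_iff)


section \<open>Matrix representations\<close>

definition phi :: "quat \<Rightarrow> real mat" where
  "phi q = mat_of_rows_list 4
    [[q0 q, - q1 q, - q2 q, - q3 q],
     [q1 q,   q0 q, - q3 q,   q2 q],
     [q2 q,   q3 q,   q0 q, - q1 q],
     [q3 q, - q2 q,   q1 q,   q0 q]]"

definition tau :: "quat \<Rightarrow> real mat" where
  "tau q = mat_of_rows_list 4
    [[q0 q, - q1 q, - q2 q, - q3 q],
     [q1 q,   q0 q,   q3 q, - q2 q],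
     [q2 q, - q3 q,   q0 q,   q1 q],
     [q3 q,   q2 q, - q1 q,   q0 q]]"

definition nu :: "oct \<Rightarrow> real mat" where
  "nu a = four_block_mat
    (tau (oct1 a)) (- phi (qcnj (oct2 a)))
    (phi (oct2 a)) (tau (qcnj (oct1 a)))"

end

theory Submission
  imports Defs
begin

text \<open>
  Write \<open>x = x' + x'' e\<close> and \<open>a = a' + a'' e\<close>, and let a star denote quaternion conjugation. The
  quaternion halves of \<open>x * a\<close> are \<open>x' a' - a''\<^sup>* x''\<close> and \<open>a'' x' + x'' a'\<^sup>*\<close>, where
  each product has exactly one factor that comes from \<open>x\<close>. On quaternion coordinates, \<open>phi q\<close> is
  left multiplication by \<open>q\<close> (lemma \<open>phi_mult_quat_vec\<close>) and \<open>tau q\<close> is right multiplication by \<open>q\<close>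
  (lemma \<open>tau_mult_quat_vec\<close>). The matrices of the four maps applied to \<open>x'\<close> and \<open>x''\<close> are therefore
  the four blocks of \<open>nu a\<close>, and block multiplication on the coordinate vector of \<open>x\<close>, split into
  its two quaternion halves, gives the claim.
\<close>

definition quat_vec :: "quat \<Rightarrow> real vec" where
  "quat_vec q = vec_of_list [q0 q, q1 q, q2 q, q3 q]"

lemma dim_quat_vec [simp]: "dim_vec (quat_vec q) = 4"
  by (simp add: quat_vec_def)

lemma quat_vec_carrier [simp]: "quat_vec q \<in> carrier_vec 4"
  by (rule carrier_vecI) simp

lemma quat_vec_index [simp]:
  "quat_vec q $ 0 = q0 q" "quat_vec q $ Suc 0 = q1 q"
  "quat_vec q $ 2 = q2 q" "quat_vec q $ 3 = q3 q"
  by (simp_all add: quat_vec_def vec_of_list_index numeral_eq_Suc)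

lemma less_4_cases: "i < 4 \<Longrightarrow> i = 0 \<or> i = Suc 0 \<or> i = 2 \<or> i = 3" for i :: nat
  by linarith

lemma vec_4_eqI:
  assumes "dim_vec v = 4" "dim_vec w = 4"
    and "v $ 0 = w $ 0" "v $ Suc 0 = w $ Suc 0" "v $ 2 = w $ 2" "v $ 3 = w $ 3"
  shows "v = w"
  using assms by (intro eq_vecI) (auto dest: less_4_cases)

lemma dim_phi [simp]: "dim_row (phi q) = 4" "dim_col (phi q) = 4"
  by (simp_all add: phi_def mat_of_rows_list_def)

lemma phi_carrier [simp]: "phi q \<in> carrier_mat 4 4"
  by (rule carrier_matI) simp_all

lemma dim_tau [simp]: "dim_row (tau q) = 4" "dim_col (tau q) = 4"
  by (simp_all add: tau_def mat_of_rows_list_def)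

lemma tau_carrier [simp]: "tau q \<in> carrier_mat 4 4"
  by (rule carrier_matI) simp_all

lemma quat_vec_add: "quat_vec (p + q) = quat_vec p + quat_vec q"
  by (rule vec_4_eqI) (simp_all add: plus_quat_def)

lemma quat_vec_diff: "quat_vec (p - q) = quat_vec p - quat_vec q"
  by (rule vec_4_eqI) (simp_all add: minus_quat_def)

lemma scalar_prod_quat_vec:
  "v \<bullet> quat_vec p = v $ 0 * q0 p + v $ Suc 0 * q1 p + v $ 2 * q2 p + v $ 3 * q3 p"
proof -
  have "{0..<4} = {0, Suc 0, 2, 3 :: nat}"
    by auto
  then show ?thesis
    by (simp add: scalar_prod_def add.assoc)
qed

text \<open>The columns of \<open>phi q\<close> are the coordinates of \<open>q\<close>, \<open>q i\<close>, \<open>q j\<close> and \<open>q k\<close>,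
  the images of the basis.\<close>

lemma phi_mult_quat_vec: "phi q *\<^sub>v quat_vec p = quat_vec (q * p)"
  by (rule vec_4_eqI)
    (simp_all add: scalar_prod_quat_vec phi_def mat_of_rows_list_def times_quat_def)

text \<open>The columns of \<open>tau q\<close> are the coordinates of \<open>q\<close>, \<open>i q\<close>, \<open>j q\<close> and \<open>k q\<close>,
  the images of the basis.\<close>

lemma tau_mult_quat_vec: "tau q *\<^sub>v quat_vec p = quat_vec (p * q)"
  by (rule vec_4_eqI)
    (simp_all add: scalar_prod_quat_vec tau_def mat_of_rows_list_def times_quat_def
      algebra_simps)

lemma oct_vec_conv_append: "oct_vec x = quat_vec (oct1 x) @\<^sub>v quat_vec (oct2 x)"
proof -
  have "list_of_vec (oct_vec x) = list_of_vec (quat_vec (oct1 x) @\<^sub>v quat_vec (oct2 x))"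
    by (simp add: oct_vec_def quat_vec_def list_vec)
  then show ?thesis
    by (metis vec_list)
qed

theorem theorem2p3:
  fixes a x :: oct
  shows "oct_vec (x * a) = nu a *\<^sub>v oct_vec x"
proof -
  let ?x1 = "quat_vec (oct1 x)" and ?x2 = "quat_vec (oct2 x)"
  have "nu a *\<^sub>v oct_vec x =
      (tau (oct1 a) *\<^sub>v ?x1 + - phi (qcnj (oct2 a)) *\<^sub>v ?x2) @\<^sub>v
      (phi (oct2 a) *\<^sub>v ?x1 + tau (qcnj (oct1 a)) *\<^sub>v ?x2)"
    unfolding nu_def oct_vec_conv_append
    \<comment> \<open>Fixing the block sizes keeps unification from choosing \<open>dim_row\<close> terms for them.\<close>
    by (rule four_block_mat_mult_vec[where ?nr1.0 = 4 and ?nc1.0 = 4 and ?nr2.0 = 4 and ?nc2.0 = 4])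
      simp_all
  also have "- phi (qcnj (oct2 a)) *\<^sub>v ?x2 = - quat_vec (qcnj (oct2 a) * oct2 x)"
    by (simp add: phi_mult_quat_vec)
  also have "tau (oct1 a) *\<^sub>v ?x1 + - quat_vec (qcnj (oct2 a) * oct2 x)
      = quat_vec (oct1 (x * a))"
    by (simp add: tau_mult_quat_vec times_oct_def quat_vec_diff minus_add_uminus_vec[of _ 4])
  also have "phi (oct2 a) *\<^sub>v ?x1 + tau (qcnj (oct1 a)) *\<^sub>v ?x2 = quat_vec (oct2 (x * a))"
    by (simp add: phi_mult_quat_vec tau_mult_quat_vec times_oct_def quat_vec_add)
  finally show ?thesis
    by (simp add: oct_vec_conv_append)
qed

end
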